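(* Let $D$ be a $\varphi$KT-connection with torsion $T$ and curvature tensor $K$ on an almost contact B-metric manifold $(M,\varphi,\xi,\eta,g)$, and suppose that $T$ is $D$-parallel, i.e. $DT=0$. Then the following conditions are equivalent: (i) The curvature tensor $K$ is a $\varphi$-Kähler-type tensor and it has the form $$K(x,y,z,w)=R(x,y,z,w)+\tfrac14 g\bigl(T(x,y),T(z,w)\bigr);$$ (ii) The torsion 3-form $T$ is closed, $\mathrm{d}T=0$; (iii) For all vector fields $x,y,z,w$, $$\mathop{\mathfrak{S}}_{x,y,z}\bigl\{g\bigl(T(x,y),T(z,w)\bigr)\bigr\}=0.$$
   Context: An almost contact B-metric manifold $(M,\varphi,\xi,\eta,g)$ is a $(2n+1)$-dimensional smooth manifold $M$ with a field of endomorphisms $\varphi$ of the tangent bundle, a vector field $\xi$, a 1-form $\eta$ and a pseudo-Riemannian metric $g$ of signature $(n,n+1)$ ($n$ negative and $n+1$ positive directions) such that $\varphi\xi=0$, $\varphi^2=-\mathrm{Id}+\eta\otimes\xi$, $\eta\circ\varphi=0$, $\eta(\xi)=1$, $g(\varphi x,\varphi y)=-g(x,y)+\eta(x)\eta(y)$. $\nabla$ is the Levi-Civita connection of $g$. $\mathfrak{S}_{x,y,z}$ denotes the cyclic sum over $x,y,z$ ($w$ fixed). A natural connection is a linear connection $D$ with $D\varphi=0$, $D\xi=0$, $D\eta=0$, $Dg=0$. Its torsion is $T(x,y)=D_xy-D_yx-[x,y]$, with $T(x,y,z)=g(T(x,y),z)$. A $\varphi$KT-connection is a natural connection whose torsion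 $T(x,y,z)$ is totally skew-symmetric (a 3-form). Curvatures: $R(x,y)z=[\nabla_x,\nabla_y]z-\nabla_{[x,y]}z$, $R(x,y,z,w)=g(R(x,y)z,w)$; $K(x,y)z=[D_x,D_y]z-D_{[x,y]}z$, $K(x,y,z,w)=g(K(x,y)z,w)$. A $(0,4)$-tensor $L$ is of $\varphi$-Kähler type if $L(x,y,z,w)=-L(y,x,z,w)=-L(x,y,w,z)$, $\mathfrak{S}_{x,y,z}L(x,y,z,w)=0$ and $L(x,y,\varphi z,\varphi w)=-L(x,y,z,w)$. *)

theory Defs
  imports "HOL-Analysis.Analysis" "HOL-Library.Function_Algebras"
begin

section \<open>Smooth manifolds\<close>

text \<open>Intended for open \<open>S\<close>; then \<open>Ck_on k S f\<close> says that \<open>f\<close> is of class \<open>C\<^sup>k\<close> on \<open>S\<close>.\<close>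

fun Ck_on :: "nat \<Rightarrow> 'b::euclidean_space set \<Rightarrow> ('b \<Rightarrow> 'c::real_normed_vector) \<Rightarrow> bool" where
  "Ck_on 0 S f = continuous_on S f"
| "Ck_on (Suc k) S f =
     (f differentiable_on S \<and> (\<forall>v. Ck_on k S (\<lambda>x. frechet_derivative f (at x) v)))"

definition smooth_on :: "'b::euclidean_space set \<Rightarrow> ('b \<Rightarrow> 'c::real_normed_vector) \<Rightarrow> bool" where
  "smooth_on S f \<longleftrightarrow> (\<forall>k. Ck_on k S f)"

text \<open>A chart is a pair of an open domain and a coordinate map.  The manifold is the whole type
  \<open>'a\<close>, which is required to be Hausdorff and second countable; its dimension is \<open>DIM('b)\<close>.\<close>

type_synonym ('a, 'b) atlas = "('a set \<times> ('a \<Rightarrow> 'b)) set"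

definition smooth_atlas ::
  "('a::{t2_space,second_countable_topology}, 'b::euclidean_space) atlas \<Rightarrow> bool" where
  "smooth_atlas A \<longleftrightarrow>
     (\<Union>(U, c)\<in>A. U) = UNIV \<and>
     (\<forall>(U, c)\<in>A. open U \<and> open (c ` U) \<and> homeomorphism U (c ` U) c (inv_into U c)) \<and>
     (\<forall>(U, c)\<in>A. \<forall>(V, d)\<in>A. smooth_on (c ` (U \<inter> V)) (d \<circ> inv_into U c))"

definition smooth_functions ::
  "('a::{t2_space,second_countable_topology}, 'b::euclidean_space) atlas \<Rightarrow> ('a \<Rightarrow> real) set" where
  "smooth_functions A = {f. \<forall>(U, c)\<in>A. smooth_on (c ` U) (f \<circ> inv_into U c)}"

section \<open>Tangent vectors and vector fields\<close>

text \<open>Tangent vectors at \<open>p\<close> are the derivations at \<open>p\<close> of the algebra of smooth functions.  They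
  are extended by \<open>0\<close> to non-smooth functions, so that equality of tangent vectors is equality
  of functionals.  Sums and differences of tangent vectors and of vector fields are the pointwise
  ones of \<^theory>\<open>HOL-Library.Function_Algebras\<close>.\<close>

type_synonym 'a tvec = "('a \<Rightarrow> real) \<Rightarrow> real"
type_synonym 'a vfield = "'a \<Rightarrow> 'a tvec"

definition tangent_space ::
  "('a::{t2_space,second_countable_topology}, 'b::euclidean_space) atlas \<Rightarrow> 'a \<Rightarrow> 'a tvec set" where
  "tangent_space A p =
     {v. (\<forall>f\<in>smooth_functions A. \<forall>h\<in>smooth_functions A.
            v (f + h) = v f + v h \<and> v (f * h) = f p * v h + h p * v f) \<and>
         (\<forall>f\<in>smooth_functions A. \<forall>a. v (\<lambda>q. a * f q) = a * v f) \<and>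
         (\<forall>f. f \<notin> smooth_functions A \<longrightarrow> v f = 0)}"

definition tscale :: "real \<Rightarrow> 'a tvec \<Rightarrow> 'a tvec" where
  "tscale a v = (\<lambda>f. a * v f)"

definition tangent_basis ::
  "('a::{t2_space,second_countable_topology}, 'b::euclidean_space) atlas \<Rightarrow> 'a \<Rightarrow>
     nat \<Rightarrow> (nat \<Rightarrow> 'a tvec) \<Rightarrow> bool" where
  "tangent_basis A p m e \<longleftrightarrow>
     (\<forall>i<m. e i \<in> tangent_space A p) \<and>
     (\<forall>v\<in>tangent_space A p. \<exists>a. v = (\<Sum>i<m. tscale (a i) (e i))) \<and>
     (\<forall>a. (\<Sum>i<m. tscale (a i) (e i)) = 0 \<longrightarrow> (\<forall>i<m. a i = 0))"

definition along :: "'a vfield \<Rightarrow> ('a \<Rightarrow> real) \<Rightarrow> 'a \<Rightarrow> real" where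
  "along x f = (\<lambda>p. x p f)"

definition vector_fields ::
  "('a::{t2_space,second_countable_topology}, 'b::euclidean_space) atlas \<Rightarrow> 'a vfield set" where
  "vector_fields A =
     {x. (\<forall>p. x p \<in> tangent_space A p) \<and>
         (\<forall>f\<in>smooth_functions A. along x f \<in> smooth_functions A)}"

definition fscale :: "('a \<Rightarrow> real) \<Rightarrow> 'a vfield \<Rightarrow> 'a vfield" where
  "fscale f x = (\<lambda>p. tscale (f p) (x p))"

text \<open>For vector fields, both terms below vanish on non-smooth \<open>f\<close>, in accordance with the
  convention for tangent vectors.\<close>

definition lie_bracket :: "'a vfield \<Rightarrow> 'a vfield \<Rightarrow> 'a vfield" where
  "lie_bracket x y = (\<lambda>p f. x p (along y f) - y p (along x f))"

section \<open>Tensor fields\<close>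

text \<open>The structure tensors \<open>\<phi>\<close>, \<open>\<eta>\<close>, \<open>g\<close> are given as fields of (multi)linear maps on the tangent
  spaces.  Smoothness means that evaluation on vector fields gives vector fields, respectively
  smooth functions.  Tensors built from connections are given directly by their action on vector
  fields.\<close>

definition app :: "('a \<Rightarrow> 'a tvec \<Rightarrow> 'c) \<Rightarrow> 'a vfield \<Rightarrow> 'a \<Rightarrow> 'c" where
  "app F x = (\<lambda>p. F p (x p))"

definition app2 :: "('a \<Rightarrow> 'a tvec \<Rightarrow> 'a tvec \<Rightarrow> real) \<Rightarrow> 'a vfield \<Rightarrow> 'a vfield \<Rightarrow> 'a \<Rightarrow> real" where
  "app2 g x y = (\<lambda>p. g p (x p) (y p))"

definition endomorphism_field ::
  "('a::{t2_space,second_countable_topology}, 'b::euclidean_space) atlas \<Rightarrow>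
     ('a \<Rightarrow> 'a tvec \<Rightarrow> 'a tvec) \<Rightarrow> bool" where
  "endomorphism_field A \<phi> \<longleftrightarrow>
     (\<forall>p. \<forall>v\<in>tangent_space A p. \<phi> p v \<in> tangent_space A p \<and>
        (\<forall>a. \<phi> p (tscale a v) = tscale a (\<phi> p v)) \<and>
        (\<forall>w\<in>tangent_space A p. \<phi> p (v + w) = \<phi> p v + \<phi> p w)) \<and>
     (\<forall>x\<in>vector_fields A. app \<phi> x \<in> vector_fields A)"

definition one_form ::
  "('a::{t2_space,second_countable_topology}, 'b::euclidean_space) atlas \<Rightarrow>
     ('a \<Rightarrow> 'a tvec \<Rightarrow> real) \<Rightarrow> bool" where
  "one_form A \<eta> \<longleftrightarrow>
     (\<forall>p. \<forall>v\<in>tangent_space A p.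
        (\<forall>a. \<eta> p (tscale a v) = a * \<eta> p v) \<and>
        (\<forall>w\<in>tangent_space A p. \<eta> p (v + w) = \<eta> p v + \<eta> p w)) \<and>
     (\<forall>x\<in>vector_fields A. app \<eta> x \<in> smooth_functions A)"

text \<open>A pseudo-Riemannian metric with \<open>r\<close> negative and \<open>s\<close> positive directions: every tangent space
  has an orthonormal basis of this type (so the metric is nondegenerate).\<close>

definition pseudo_riemannian_metric ::
  "('a::{t2_space,second_countable_topology}, 'b::euclidean_space) atlas \<Rightarrow> nat \<Rightarrow> nat \<Rightarrow>
     ('a \<Rightarrow> 'a tvec \<Rightarrow> 'a tvec \<Rightarrow> real) \<Rightarrow> bool" where
  "pseudo_riemannian_metric A r s g \<longleftrightarrow>
     (\<forall>p. \<forall>u\<in>tangent_space A p. \<forall>v\<in>tangent_space A p.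
        g p u v = g p v u \<and>
        (\<forall>a. g p (tscale a u) v = a * g p u v) \<and>
        (\<forall>w\<in>tangent_space A p. g p (u + w) v = g p u v + g p w v)) \<and>
     (\<forall>x\<in>vector_fields A. \<forall>y\<in>vector_fields A. app2 g x y \<in> smooth_functions A) \<and>
     (\<forall>p. \<exists>e. tangent_basis A p (r + s) e \<and>
        (\<forall>i<r + s. \<forall>j<r + s. g p (e i) (e j) = (if i \<noteq> j then 0 else if i < r then -1 else 1)))"

definition almost_contact_B_metric_manifold ::
  "('a::{t2_space,second_countable_topology}, 'b::euclidean_space) atlas \<Rightarrow> nat \<Rightarrow>
     ('a \<Rightarrow> 'a tvec \<Rightarrow> 'a tvec) \<Rightarrow> 'a vfield \<Rightarrow> ('a \<Rightarrow> 'a tvec \<Rightarrow> real) \<Rightarrow>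
     ('a \<Rightarrow> 'a tvec \<Rightarrow> 'a tvec \<Rightarrow> real) \<Rightarrow> bool" where
  "almost_contact_B_metric_manifold A n \<phi> \<xi> \<eta> g \<longleftrightarrow>
     smooth_atlas A \<and> DIM('b) = 2 * n + 1 \<and>
     endomorphism_field A \<phi> \<and> \<xi> \<in> vector_fields A \<and> one_form A \<eta> \<and>
     pseudo_riemannian_metric A n (n + 1) g \<and>
     (\<forall>p. \<phi> p (\<xi> p) = 0 \<and> \<eta> p (\<xi> p) = 1 \<and>
        (\<forall>v\<in>tangent_space A p.
           \<phi> p (\<phi> p v) = - v + tscale (\<eta> p v) (\<xi> p) \<and>
           \<eta> p (\<phi> p v) = 0 \<and>
           (\<forall>w\<in>tangent_space A p. g p (\<phi> p v) (\<phi> p w) = - g p v w + \<eta> p v * \<eta> p w)))"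

section \<open>Connections\<close>

type_synonym 'a connection = "'a vfield \<Rightarrow> 'a vfield \<Rightarrow> 'a vfield"

definition linear_connection ::
  "('a::{t2_space,second_countable_topology}, 'b::euclidean_space) atlas \<Rightarrow>
     'a connection \<Rightarrow> bool" where
  "linear_connection A D \<longleftrightarrow>
     (\<forall>x\<in>vector_fields A. \<forall>y\<in>vector_fields A. D x y \<in> vector_fields A \<and>
        (\<forall>z\<in>vector_fields A. D (x + z) y = D x y + D z y \<and> D x (y + z) = D x y + D x z) \<and>
        (\<forall>f\<in>smooth_functions A.
           D (fscale f x) y = fscale f (D x y) \<and>
           D x (fscale f y) = fscale (along x f) y + fscale f (D x y)))"

definition torsion :: "'a connection \<Rightarrow> 'a vfield \<Rightarrow> 'a vfield \<Rightarrow> 'a vfield" where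
  "torsion D x y = D x y - D y x - lie_bracket x y"

definition torsion3 :: "('a \<Rightarrow> 'a tvec \<Rightarrow> 'a tvec \<Rightarrow> real) \<Rightarrow> 'a connection \<Rightarrow>
    'a vfield \<Rightarrow> 'a vfield \<Rightarrow> 'a vfield \<Rightarrow> 'a \<Rightarrow> real" where
  "torsion3 g D x y z = app2 g (torsion D x y) z"

definition curvature ::
  "'a connection \<Rightarrow> 'a vfield \<Rightarrow> 'a vfield \<Rightarrow> 'a vfield \<Rightarrow> 'a vfield" where
  "curvature D x y z = D x (D y z) - D y (D x z) - D (lie_bracket x y) z"

definition curvature4 :: "('a \<Rightarrow> 'a tvec \<Rightarrow> 'a tvec \<Rightarrow> real) \<Rightarrow> 'a connection \<Rightarrow>
    'a vfield \<Rightarrow> 'a vfield \<Rightarrow> 'a vfield \<Rightarrow> 'a vfield \<Rightarrow> 'a \<Rightarrow> real" where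
  "curvature4 g D x y z w = app2 g (curvature D x y z) w"

text \<open>The covariant derivative in direction \<open>x\<close> of an endomorphism field, a 1-form, a \<open>(0,2)\<close>-tensor
  and a \<open>(1,2)\<close>-tensor.\<close>

definition cov_endo :: "'a connection \<Rightarrow> ('a \<Rightarrow> 'a tvec \<Rightarrow> 'a tvec) \<Rightarrow>
    'a vfield \<Rightarrow> 'a vfield \<Rightarrow> 'a vfield" where
  "cov_endo D \<phi> x y = D x (app \<phi> y) - app \<phi> (D x y)"

definition cov_one_form :: "'a connection \<Rightarrow> ('a \<Rightarrow> 'a tvec \<Rightarrow> real) \<Rightarrow>
    'a vfield \<Rightarrow> 'a vfield \<Rightarrow> 'a \<Rightarrow> real" where
  "cov_one_form D \<eta> x y = along x (app \<eta> y) - app \<eta> (D x y)"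

definition cov_bilinear :: "'a connection \<Rightarrow> ('a \<Rightarrow> 'a tvec \<Rightarrow> 'a tvec \<Rightarrow> real) \<Rightarrow>
    'a vfield \<Rightarrow> 'a vfield \<Rightarrow> 'a vfield \<Rightarrow> 'a \<Rightarrow> real" where
  "cov_bilinear D g x y z = along x (app2 g y z) - app2 g (D x y) z - app2 g y (D x z)"

definition cov_tensor12 :: "'a connection \<Rightarrow> ('a vfield \<Rightarrow> 'a vfield \<Rightarrow> 'a vfield) \<Rightarrow>
    'a vfield \<Rightarrow> 'a vfield \<Rightarrow> 'a vfield \<Rightarrow> 'a vfield" where
  "cov_tensor12 D T x y z = D x (T y z) - T (D x y) z - T y (D x z)"

definition levi_civita ::
  "('a::{t2_space,second_countable_topology}, 'b::euclidean_space) atlas \<Rightarrow>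
     ('a \<Rightarrow> 'a tvec \<Rightarrow> 'a tvec \<Rightarrow> real) \<Rightarrow> 'a connection \<Rightarrow> bool" where
  "levi_civita A g D \<longleftrightarrow> linear_connection A D \<and>
     (\<forall>x\<in>vector_fields A. \<forall>y\<in>vector_fields A. torsion D x y = 0) \<and>
     (\<forall>x\<in>vector_fields A. \<forall>y\<in>vector_fields A. \<forall>z\<in>vector_fields A. cov_bilinear D g x y z = 0)"

definition natural_connection ::
  "('a::{t2_space,second_countable_topology}, 'b::euclidean_space) atlas \<Rightarrow>
     ('a \<Rightarrow> 'a tvec \<Rightarrow> 'a tvec) \<Rightarrow> 'a vfield \<Rightarrow> ('a \<Rightarrow> 'a tvec \<Rightarrow> real) \<Rightarrow>
     ('a \<Rightarrow> 'a tvec \<Rightarrow> 'a tvec \<Rightarrow> real) \<Rightarrow> 'a connection \<Rightarrow> bool" where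
  "natural_connection A \<phi> \<xi> \<eta> g D \<longleftrightarrow> linear_connection A D \<and>
     (\<forall>x\<in>vector_fields A. D x \<xi> = 0 \<and>
        (\<forall>y\<in>vector_fields A. cov_endo D \<phi> x y = 0 \<and> cov_one_form D \<eta> x y = 0 \<and>
           (\<forall>z\<in>vector_fields A. cov_bilinear D g x y z = 0)))"

definition phiKT_connection ::
  "('a::{t2_space,second_countable_topology}, 'b::euclidean_space) atlas \<Rightarrow>
     ('a \<Rightarrow> 'a tvec \<Rightarrow> 'a tvec) \<Rightarrow> 'a vfield \<Rightarrow> ('a \<Rightarrow> 'a tvec \<Rightarrow> real) \<Rightarrow>
     ('a \<Rightarrow> 'a tvec \<Rightarrow> 'a tvec \<Rightarrow> real) \<Rightarrow> 'a connection \<Rightarrow> bool" where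
  "phiKT_connection A \<phi> \<xi> \<eta> g D \<longleftrightarrow> natural_connection A \<phi> \<xi> \<eta> g D \<and>
     (\<forall>x\<in>vector_fields A. \<forall>y\<in>vector_fields A. \<forall>z\<in>vector_fields A.
        torsion3 g D x y z = - torsion3 g D y x z \<and>
        torsion3 g D x y z = - torsion3 g D x z y)"

definition parallel_torsion ::
  "('a::{t2_space,second_countable_topology}, 'b::euclidean_space) atlas \<Rightarrow>
     'a connection \<Rightarrow> bool" where
  "parallel_torsion A D \<longleftrightarrow>
     (\<forall>x\<in>vector_fields A. \<forall>y\<in>vector_fields A. \<forall>z\<in>vector_fields A.
        cov_tensor12 D (torsion D) x y z = 0)"

section \<open>Curvature-like tensors and the exterior derivative\<close>

definition cyclic_sum :: "('c \<Rightarrow> 'c \<Rightarrow> 'c \<Rightarrow> 'd::ab_group_add) \<Rightarrow> 'c \<Rightarrow> 'c \<Rightarrow> 'c \<Rightarrow> 'd" where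
  "cyclic_sum F x y z = F x y z + F y z x + F z x y"

definition tensor04 ::
  "('a::{t2_space,second_countable_topology}, 'b::euclidean_space) atlas \<Rightarrow>
     ('a vfield \<Rightarrow> 'a vfield \<Rightarrow> 'a vfield \<Rightarrow> 'a vfield \<Rightarrow> 'a \<Rightarrow> real) \<Rightarrow> bool" where
  "tensor04 A L \<longleftrightarrow>
     (\<forall>x\<in>vector_fields A. \<forall>y\<in>vector_fields A. \<forall>z\<in>vector_fields A. \<forall>w\<in>vector_fields A.
        L x y z w \<in> smooth_functions A \<and>
        (\<forall>u\<in>vector_fields A.
           L (x + u) y z w = L x y z w + L u y z w \<and>
           L x (y + u) z w = L x y z w + L x u z w \<and>
           L x y (z + u) w = L x y z w + L x y u w \<and>
           L x y z (w + u) = L x y z w + L x y z u) \<and>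
        (\<forall>f\<in>smooth_functions A.
           L (fscale f x) y z w = f * L x y z w \<and>
           L x (fscale f y) z w = f * L x y z w \<and>
           L x y (fscale f z) w = f * L x y z w \<and>
           L x y z (fscale f w) = f * L x y z w))"

definition phi_kaehler_type ::
  "('a::{t2_space,second_countable_topology}, 'b::euclidean_space) atlas \<Rightarrow>
     ('a \<Rightarrow> 'a tvec \<Rightarrow> 'a tvec) \<Rightarrow>
     ('a vfield \<Rightarrow> 'a vfield \<Rightarrow> 'a vfield \<Rightarrow> 'a vfield \<Rightarrow> 'a \<Rightarrow> real) \<Rightarrow> bool" where
  "phi_kaehler_type A \<phi> L \<longleftrightarrow> tensor04 A L \<and>
     (\<forall>x\<in>vector_fields A. \<forall>y\<in>vector_fields A. \<forall>z\<in>vector_fields A. \<forall>w\<in>vector_fields A.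
        L x y z w = - L y x z w \<and>
        L x y z w = - L x y w z \<and>
        cyclic_sum (\<lambda>x y z. L x y z w) x y z = 0 \<and>
        L x y (app \<phi> z) (app \<phi> w) = - L x y z w)"

text \<open>The invariant formula
  \<open>d\<omega>(x\<^sub>0,\<dots>,x\<^sub>3) = \<Sum>i. (-1)^i x\<^sub>i \<omega>(\<dots>) + \<Sum>i<j. (-1)^(i+j) \<omega>([x\<^sub>i,x\<^sub>j],\<dots>)\<close> for a 3-form, where
  the arguments \<open>x\<^sub>i\<close> (and \<open>x\<^sub>j\<close>) are omitted from the dots.\<close>

definition ext_deriv3 :: "('a vfield \<Rightarrow> 'a vfield \<Rightarrow> 'a vfield \<Rightarrow> 'a \<Rightarrow> real) \<Rightarrow>
    'a vfield \<Rightarrow> 'a vfield \<Rightarrow> 'a vfield \<Rightarrow> 'a vfield \<Rightarrow> 'a \<Rightarrow> real" where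
  "ext_deriv3 \<omega> x y z w =
     along x (\<omega> y z w) - along y (\<omega> x z w) + along z (\<omega> x y w) - along w (\<omega> x y z)
     - \<omega> (lie_bracket x y) z w + \<omega> (lie_bracket x z) y w - \<omega> (lie_bracket x w) y z
     - \<omega> (lie_bracket y z) x w + \<omega> (lie_bracket y w) x z - \<omega> (lie_bracket z w) x y"

end

theory Submission
  imports Defs
begin

text \<open>All tensors are compared after pairing with a vector field through \<open>g\<close>.  Put
  \<open>\<sigma>(x,y,z,w) = \<SS>\<^bsub>x,y,z\<^esub> g(T(x,y),T(z,w))\<close>.  Since \<open>T\<close> is totally skew-symmetric, the Koszul
  argument gives \<open>g(D\<^sub>x y,z) = g(\<nabla>\<^sub>x y,z) + T(x,y,z)/2\<close>; together with \<open>DT = 0\<close> this yields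
  \<open>K(x,y,z,w) = R(x,y,z,w) + g(T(x,y),T(z,w))/4 + \<sigma>(x,y,z,w)/4\<close> and \<open>dT = 2\<sigma>\<close>.  Hence (ii), (iii)
  and the formula for \<open>K\<close> in (i) all say \<open>\<sigma> = 0\<close>.  The Bianchi identity for \<open>R\<close> turns the formula
  for \<open>K\<close> into \<open>\<SS>\<^bsub>x,y,z\<^esub> K(x,y,z,w) = \<sigma>(x,y,z,w)\<close>, so \<open>\<sigma> = 0\<close> also makes \<open>K\<close> of \<open>\<phi>\<close>-Kaehler type.\<close>

section \<open>Smooth functions and vector fields\<close>

text \<open>The derivative at a point of an open set depends only on the values nearby, so agreement
  on \<open>S\<close> passes to all derivatives. The sum and product rules below identify
  derivatives only at points of \<open>S\<close>, which is why their inductions go through this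
  congruence.\<close>

lemma Ck_on_cong:
  assumes "open S" "\<And>x. x \<in> S \<Longrightarrow> f x = g x" "Ck_on k S f"
  shows "Ck_on k S g"
  using assms(2,3)
proof (induction k arbitrary: f g)
  case 0
  then show ?case
    using continuous_on_cong[of S S f g] by simp
next
  case (Suc k)
  have fd: "f differentiable (at x)" if "x \<in> S" for x
    using Suc.prems(2) that \<open>open S\<close> by (simp add: differentiable_on_eq_differentiable_at)
  have "g differentiable_on S"
    using fd Suc.prems(1) \<open>open S\<close>
    unfolding differentiable_on_eq_differentiable_at[OF \<open>open S\<close>]
    by (metis differentiable_def has_derivative_transform_within_open)
  moreover have "frechet_derivative f (at x) = frechet_derivative g (at x)" if "x \<in> S" for x
    by (rule frechet_derivative_transform_within_open[OF fd[OF that] \<open>open S\<close> that])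
       (simp add: Suc.prems)
  then have "Ck_on k S (\<lambda>x. frechet_derivative g (at x) v)" for v
    using Suc.IH[of "\<lambda>x. frechet_derivative f (at x) v" "\<lambda>x. frechet_derivative g (at x) v"]
      Suc.prems(2) by simp
  ultimately show ?case
    by simp
qed

text \<open>Needed for products: the product rule leaves one factor undifferentiated, and the
  induction hypothesis wants that factor in the lower class.\<close>

lemma Ck_on_Suc_imp: "Ck_on (Suc k) S f \<Longrightarrow> Ck_on k S f"
  by (induction k arbitrary: f) (auto simp: differentiable_imp_continuous_on)

lemma Ck_on_add:
  assumes "open S" "Ck_on k S f" "Ck_on k S g"
  shows "Ck_on k S (\<lambda>x. f x + g x)"
  using assms(2,3)
proof (induction k arbitrary: f g)
  case 0
  then show ?case by (simp add: continuous_on_add)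
next
  case (Suc k)
  have fg: "f differentiable (at x)" "g differentiable (at x)" if "x \<in> S" for x
    using Suc.prems that \<open>open S\<close> by (auto simp: differentiable_on_eq_differentiable_at)
  have "frechet_derivative f (at x) v + frechet_derivative g (at x) v
      = frechet_derivative (\<lambda>x. f x + g x) (at x) v" if "x \<in> S" for x v
    using fg[OF that, unfolded frechet_derivative_works]
    by (subst frechet_derivative_at[symmetric, OF has_derivative_add]) auto
  moreover have "Ck_on k S (\<lambda>x. frechet_derivative f (at x) v + frechet_derivative g (at x) v)" for v
    using Suc.prems by (intro Suc.IH) simp_all
  ultimately have "Ck_on k S (\<lambda>x. frechet_derivative (\<lambda>x. f x + g x) (at x) v)" for v
    by (rule Ck_on_cong[OF \<open>open S\<close>])
  then show ?case
    using Suc.prems by simp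
qed

lemma Ck_on_mult:
  fixes f g :: "'b::euclidean_space \<Rightarrow> 'c::real_normed_algebra"
  assumes "open S" "Ck_on k S f" "Ck_on k S g"
  shows "Ck_on k S (\<lambda>x. f x * g x)"
  using assms(2,3)
proof (induction k arbitrary: f g)
  case 0
  then show ?case by (simp add: continuous_on_mult)
next
  case (Suc k)
  have fg: "f differentiable (at x)" "g differentiable (at x)" if "x \<in> S" for x
    using Suc.prems that \<open>open S\<close> by (auto simp: differentiable_on_eq_differentiable_at)
  have "f x * frechet_derivative g (at x) v + frechet_derivative f (at x) v * g x
      = frechet_derivative (\<lambda>x. f x * g x) (at x) v" if "x \<in> S" for x v
    using fg[OF that, unfolded frechet_derivative_works]
    by (subst frechet_derivative_at[symmetric, OF has_derivative_mult]) auto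
  moreover have "Ck_on k S
      (\<lambda>x. f x * frechet_derivative g (at x) v + frechet_derivative f (at x) v * g x)" for v
    using Suc.prems Ck_on_Suc_imp[of k S f] Ck_on_Suc_imp[of k S g]
    by (intro Ck_on_add[OF \<open>open S\<close>] Suc.IH) (simp_all del: Ck_on.simps(1))
  ultimately have "Ck_on k S (\<lambda>x. frechet_derivative (\<lambda>x. f x * g x) (at x) v)" for v
    by (rule Ck_on_cong[OF \<open>open S\<close>])
  then show ?case
    using Suc.prems by simp
qed

lemma Ck_on_const: "Ck_on k S (\<lambda>x. c)"
  by (induction k arbitrary: c) auto

section \<open>Vector fields as derivations of the smooth functions, and their Lie bracket\<close>

locale manifold =
  fixes A :: "('a::{t2_space,second_countable_topology}, 'b::euclidean_space) atlas"
  assumes atlas: "smooth_atlas A"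
begin

abbreviation "S \<equiv> smooth_functions A"
abbreviation "V \<equiv> vector_fields A"

lemma open_chart: "(U, c) \<in> A \<Longrightarrow> open (c ` U)"
  using atlas by (auto simp: smooth_atlas_def)

lemma smooth_add: "f \<in> S \<Longrightarrow> h \<in> S \<Longrightarrow> f + h \<in> S"
  by (auto simp: smooth_functions_def smooth_on_def comp_def intro!: Ck_on_add open_chart)

lemma smooth_mult: "f \<in> S \<Longrightarrow> h \<in> S \<Longrightarrow> f * h \<in> S"
  by (auto simp: smooth_functions_def smooth_on_def comp_def intro!: Ck_on_mult open_chart)

lemma smooth_const: "(\<lambda>p. a) \<in> S"
  by (auto simp: smooth_functions_def smooth_on_def comp_def Ck_on_const)

lemma smooth_cmult: "f \<in> S \<Longrightarrow> (\<lambda>p. a * f p) \<in> S"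
  using smooth_mult[OF smooth_const[of a]] by (simp add: times_fun_def)

lemma smooth_zero: "0 \<in> S"
  using smooth_const[of 0] by (simp add: zero_fun_def)

lemma smooth_uminus: "f \<in> S \<Longrightarrow> - f \<in> S"
  using smooth_cmult[of f "-1"] by (simp add: fun_Compl_def)

lemma smooth_diff: "f \<in> S \<Longrightarrow> h \<in> S \<Longrightarrow> f - h \<in> S"
  using smooth_add[of f "- h"] smooth_uminus[of h] by simp

lemma tangent_add: "v \<in> tangent_space A p \<Longrightarrow> w \<in> tangent_space A p \<Longrightarrow> v + w \<in> tangent_space A p"
  by (simp add: tangent_space_def algebra_simps)

lemma tangent_tscale: "v \<in> tangent_space A p \<Longrightarrow> tscale a v \<in> tangent_space A p"
  by (simp add: tangent_space_def tscale_def algebra_simps)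

lemma vf_tangent: "x \<in> V \<Longrightarrow> x p \<in> tangent_space A p"
  by (simp add: vector_fields_def)

lemma along_smooth: "x \<in> V \<Longrightarrow> f \<in> S \<Longrightarrow> along x f \<in> S"
  by (simp add: vector_fields_def)

lemma along_add: "x \<in> V \<Longrightarrow> f \<in> S \<Longrightarrow> h \<in> S \<Longrightarrow> along x (f + h) = along x f + along x h"
  using vf_tangent[of x] by (auto simp: tangent_space_def along_def)

lemma along_mult:
  "x \<in> V \<Longrightarrow> f \<in> S \<Longrightarrow> h \<in> S \<Longrightarrow> along x (f * h) = f * along x h + h * along x f"
  using vf_tangent[of x] by (auto simp: tangent_space_def along_def)

lemma along_cmult: "x \<in> V \<Longrightarrow> f \<in> S \<Longrightarrow> along x (\<lambda>p. a * f p) = (\<lambda>p. a * along x f p)"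
  using vf_tangent[of x] by (auto simp: tangent_space_def along_def)

lemma along_uminus: "x \<in> V \<Longrightarrow> f \<in> S \<Longrightarrow> along x (- f) = - along x f"
  using along_cmult[of x f "-1"] by (simp add: fun_Compl_def)

lemma along_diff: "x \<in> V \<Longrightarrow> f \<in> S \<Longrightarrow> h \<in> S \<Longrightarrow> along x (f - h) = along x f - along x h"
  using along_add[of x f "- h"] along_uminus[of x h] smooth_uminus[of h] by simp

lemma along_zero: "x \<in> V \<Longrightarrow> along x 0 = 0"
  using along_diff[of x 0 0] smooth_zero by simp

lemma along_nonsmooth: "x \<in> V \<Longrightarrow> f \<notin> S \<Longrightarrow> along x f = 0"
  using vf_tangent[of x] by (auto simp: tangent_space_def along_def)

text \<open>Both fields vanish on non-smooth functions by convention, so testing on \<open>S\<close>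
  suffices. Identities between brackets thereby reduce to identities between iterated
  derivatives.\<close>

lemma vf_eqI:
  assumes "x \<in> V" "y \<in> V" "\<And>f. f \<in> S \<Longrightarrow> along x f = along y f"
  shows "x = y"
proof (intro ext)
  fix p f
  have "along x f = along y f"
    using assms along_nonsmooth by (cases "f \<in> S") simp_all
  then show "x p f = y p f"
    by (metis along_def)
qed

lemma along_add_left: "along (x + y) f = along x f + along y f"
  by (auto simp: along_def)

lemma along_diff_left: "along (x - y) f = along x f - along y f"
  by (auto simp: along_def)

lemma along_uminus_left: "along (- x) f = - along x f"
  by (auto simp: along_def)

lemma along_zero_left: "along 0 f = 0"
  by (auto simp: along_def)

lemma along_fscale: "along (fscale h x) f = h * along x f"
  by (auto simp: along_def fscale_def tscale_def)

lemma along_lie_bracket: "along (lie_bracket x y) f = along x (along y f) - along y (along x f)"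
  by (auto simp: along_def lie_bracket_def)

lemmas along_left = along_add_left along_diff_left along_uminus_left along_zero_left
  along_fscale along_lie_bracket

lemma vf_add: "x \<in> V \<Longrightarrow> y \<in> V \<Longrightarrow> x + y \<in> V"
  by (auto simp: vector_fields_def along_add_left smooth_add tangent_add)

lemma vf_fscale: "f \<in> S \<Longrightarrow> x \<in> V \<Longrightarrow> fscale f x \<in> V"
  by (auto simp: vector_fields_def along_fscale smooth_mult tangent_tscale)
     (simp add: fscale_def tangent_tscale)

lemma uminus_fscale: "- x = fscale (\<lambda>p. - 1) x"
  by (simp add: fscale_def tscale_def fun_eq_iff)

lemma vf_uminus: "x \<in> V \<Longrightarrow> - x \<in> V"
  by (subst uminus_fscale) (rule vf_fscale[OF smooth_const])

lemma vf_diff: "x \<in> V \<Longrightarrow> y \<in> V \<Longrightarrow> x - y \<in> V"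
  using vf_add[of x "- y"] vf_uminus[of y] by simp

lemma vf_zero: "0 \<in> V"
  by (auto simp: vector_fields_def along_zero_left smooth_zero tangent_space_def)

text \<open>For non-smooth \<open>f\<close> the inner derivatives are the zero function, which is
  smooth and has derivative zero.\<close>

lemma lie_bracket_nonsmooth:
  assumes "x \<in> V" "y \<in> V" "f \<notin> S"
  shows "lie_bracket x y p f = 0"
  using along_zero[OF assms(1)] along_zero[OF assms(2)] along_nonsmooth assms
  by (metis along_def diff_self lie_bracket_def zero_fun_apply)

text \<open>In the commutator of two derivations the mixed products of first derivatives of
  \<open>f\<close> and \<open>h\<close> cancel, which leaves the Leibniz rule.\<close>

lemma vf_lie_bracket:
  assumes x: "x \<in> V" and y: "y \<in> V"
  shows "lie_bracket x y \<in> V"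
proof -
  let ?b = "lie_bracket x y"
  note [simp] = x y smooth_add smooth_mult along_smooth along_add along_mult along_cmult
    smooth_cmult
  have b: "?b p f = along ?b f p" for p f
    by (simp add: along_def)
  have "?b p \<in> tangent_space A p" for p
    unfolding tangent_space_def
    using lie_bracket_nonsmooth[OF x y]
    by (simp add: b along_lie_bracket algebra_simps)
  moreover have "along ?b f \<in> S" if "f \<in> S" for f
    using that by (simp add: along_lie_bracket smooth_diff)
  ultimately show ?thesis
    unfolding vector_fields_def by blast
qed

lemma lie_bracket_add_left:
  assumes "x \<in> V" "y \<in> V" "z \<in> V"
  shows "lie_bracket (x + y) z = lie_bracket x z + lie_bracket y z"
  by (rule vf_eqI)
     (simp_all add: assms vf_add vf_lie_bracket along_left along_add along_smooth)

lemma lie_bracket_fscale_left: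
  assumes "x \<in> V" "y \<in> V" "f \<in> S"
  shows "lie_bracket (fscale f x) y = fscale f (lie_bracket x y) - fscale (along y f) x"
  by (rule vf_eqI)
     (simp_all add: assms vf_diff vf_fscale vf_lie_bracket along_left along_mult along_smooth
        fun_eq_iff algebra_simps)

lemma lie_bracket_swap: "lie_bracket y x = - lie_bracket x y"
  by (simp add: lie_bracket_def fun_eq_iff)

text \<open>Applied to a smooth function, the three double brackets expand to twelve threefold
  derivatives that cancel in pairs.\<close>

lemma jacobi:
  assumes "x \<in> V" "y \<in> V" "z \<in> V"
  shows "cyclic_sum (\<lambda>x y z. lie_bracket x (lie_bracket y z)) x y z = 0"
  by (rule vf_eqI)
     (simp_all add: cyclic_sum_def assms vf_add vf_zero vf_lie_bracket along_left along_diff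
        along_smooth)

end

section \<open>Connections and their curvature\<close>

locale connection = manifold A
  for A :: "('a::{t2_space,second_countable_topology}, 'b::euclidean_space) atlas" +
  fixes D :: "'a connection"
  assumes linear: "linear_connection A D"
begin

lemma vf_conn: "x \<in> V \<Longrightarrow> y \<in> V \<Longrightarrow> D x y \<in> V"
  using linear by (simp add: linear_connection_def)

lemma conn_add_left: "x \<in> V \<Longrightarrow> z \<in> V \<Longrightarrow> y \<in> V \<Longrightarrow> D (x + z) y = D x y + D z y"
  using linear by (simp add: linear_connection_def)

lemma conn_add_right: "x \<in> V \<Longrightarrow> y \<in> V \<Longrightarrow> z \<in> V \<Longrightarrow> D x (y + z) = D x y + D x z"
  using linear by (simp add: linear_connection_def)

lemma conn_fscale_left: "x \<in> V \<Longrightarrow> y \<in> V \<Longrightarrow> f \<in> S \<Longrightarrow> D (fscale f x) y = fscale f (D x y)"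
  using linear by (simp add: linear_connection_def)

lemma conn_fscale_right:
  "x \<in> V \<Longrightarrow> y \<in> V \<Longrightarrow> f \<in> S \<Longrightarrow> D x (fscale f y) = fscale (along x f) y + fscale f (D x y)"
  using linear by (simp add: linear_connection_def)

lemma conn_diff_left:
  assumes "x \<in> V" "z \<in> V" "y \<in> V"
  shows "D (x - z) y = D x y - D z y"
  using conn_add_left[of "x - z" z y] assms by (simp add: vf_diff)

lemma conn_diff_right:
  assumes "x \<in> V" "y \<in> V" "z \<in> V"
  shows "D x (y - z) = D x y - D x z"
  using conn_add_right[of x "y - z" z] assms by (simp add: vf_diff)

lemma conn_uminus_left: "x \<in> V \<Longrightarrow> y \<in> V \<Longrightarrow> D (- x) y = - D x y"
  using conn_diff_left[of 0 x y] conn_diff_left[of x x y] by (simp add: vf_zero)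

lemma vf_torsion: "x \<in> V \<Longrightarrow> y \<in> V \<Longrightarrow> torsion D x y \<in> V"
  by (simp add: torsion_def vf_diff vf_conn vf_lie_bracket)

lemma vf_curvature: "x \<in> V \<Longrightarrow> y \<in> V \<Longrightarrow> z \<in> V \<Longrightarrow> curvature D x y z \<in> V"
  by (simp add: curvature_def vf_diff vf_conn vf_lie_bracket)

lemma curvature_swap:
  "x \<in> V \<Longrightarrow> y \<in> V \<Longrightarrow> z \<in> V \<Longrightarrow> curvature D y x z = - curvature D x y z"
  by (simp add: curvature_def lie_bracket_swap[of y x] conn_uminus_left vf_lie_bracket)

lemma curvature_add_left:
  assumes "x \<in> V" "u \<in> V" "y \<in> V" "z \<in> V"
  shows "curvature D (x + u) y z = curvature D x y z + curvature D u y z"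
  using assms
  by (simp add: curvature_def lie_bracket_add_left conn_add_left conn_add_right vf_conn
      vf_lie_bracket)

lemma curvature_add_right:
  assumes "x \<in> V" "u \<in> V" "y \<in> V" "z \<in> V"
  shows "curvature D x y (z + u) = curvature D x y z + curvature D x y u"
  using assms by (simp add: curvature_def conn_add_right vf_conn vf_lie_bracket)

text \<open>The Leibniz term of \<open>D y (fscale f (D x z))\<close> is cancelled by the term
  \<open>fscale (along y f) x\<close> in the bracket of \<open>fscale f x\<close> with
  \<open>y\<close>.\<close>

lemma curvature_fscale_left:
  assumes "x \<in> V" "y \<in> V" "z \<in> V" "f \<in> S"
  shows "curvature D (fscale f x) y z = fscale f (curvature D x y z)"
  using assms
  by (simp add: curvature_def lie_bracket_fscale_left conn_fscale_left conn_fscale_right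
      conn_diff_left vf_conn vf_lie_bracket vf_fscale along_smooth)
     (simp add: fscale_def tscale_def fun_eq_iff algebra_simps)

text \<open>The mixed first-order terms are symmetric in \<open>x\<close> and \<open>y\<close> and
  cancel; the second derivatives of \<open>f\<close> combine to the derivative along
  \<open>lie_bracket x y\<close>, which the last term of the curvature removes.\<close>

lemma curvature_fscale_right:
  assumes "x \<in> V" "y \<in> V" "z \<in> V" "f \<in> S"
  shows "curvature D x y (fscale f z) = fscale f (curvature D x y z)"
  using assms
  by (simp add: curvature_def conn_fscale_right conn_add_right vf_conn vf_lie_bracket vf_fscale
      along_smooth along_lie_bracket)
     (simp add: fscale_def tscale_def fun_eq_iff algebra_simps)

text \<open>Grouping the second derivatives by their outer direction turns each group into a double
  bracket, so the cyclic sum vanishes by the Jacobi identity.\<close>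

lemma torsion_free_bianchi:
  assumes free: "\<And>x y. x \<in> V \<Longrightarrow> y \<in> V \<Longrightarrow> torsion D x y = 0"
    and V: "x \<in> V" "y \<in> V" "z \<in> V"
  shows "cyclic_sum (curvature D) x y z = 0"
proof -
  have sym: "D u v - D v u = lie_bracket u v" if "u \<in> V" "v \<in> V" for u v
    using free[OF that] by (simp add: torsion_def)
  \<comment> \<open>Vanishing torsion is used twice: \<open>D v w - D w v\<close> becomes
    \<open>lie_bracket v w\<close>, and then \<open>u\<close> is exchanged with this
    bracket.\<close>
  have step: "D u (D v w) - D u (D w v) - D (lie_bracket v w) u = lie_bracket u (lie_bracket v w)"
    if "u \<in> V" "v \<in> V" "w \<in> V" for u v w
    using that sym[of u "lie_bracket v w"] sym[of v w]
    by (simp add: conn_diff_right[symmetric] vf_conn vf_lie_bracket)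
  have "cyclic_sum (curvature D) x y z
      = (D x (D y z) - D x (D z y) - D (lie_bracket y z) x)
      + (D y (D z x) - D y (D x z) - D (lie_bracket z x) y)
      + (D z (D x y) - D z (D y x) - D (lie_bracket x y) z)"
    by (simp add: cyclic_sum_def curvature_def)
  also have "\<dots> = 0"
    using jacobi[OF V] V by (simp add: step cyclic_sum_def)
  finally show ?thesis .
qed

end

section \<open>Bilinearity of the metric, and connections that preserve it\<close>

locale metric_manifold = manifold A
  for A :: "('a::{t2_space,second_countable_topology}, 'b::euclidean_space) atlas" +
  fixes r s :: nat and g :: "'a \<Rightarrow> 'a tvec \<Rightarrow> 'a tvec \<Rightarrow> real"
  assumes metric: "pseudo_riemannian_metric A r s g"
begin

abbreviation "G \<equiv> app2 g"

lemma metric_smooth: "x \<in> V \<Longrightarrow> y \<in> V \<Longrightarrow> G x y \<in> S"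
  using metric by (simp add: pseudo_riemannian_metric_def)

lemma metric_commute: "x \<in> V \<Longrightarrow> y \<in> V \<Longrightarrow> G x y = G y x"
  using metric by (auto simp: pseudo_riemannian_metric_def app2_def vf_tangent)

lemma metric_add_left: "x \<in> V \<Longrightarrow> y \<in> V \<Longrightarrow> z \<in> V \<Longrightarrow> G (x + y) z = G x z + G y z"
  using metric by (auto simp: pseudo_riemannian_metric_def app2_def vf_tangent)

lemma metric_fscale_left: "x \<in> V \<Longrightarrow> y \<in> V \<Longrightarrow> G (fscale f x) y = f * G x y"
  using metric by (auto simp: pseudo_riemannian_metric_def app2_def vf_tangent fscale_def)

lemma metric_diff_left: "x \<in> V \<Longrightarrow> y \<in> V \<Longrightarrow> z \<in> V \<Longrightarrow> G (x - y) z = G x z - G y z"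
  using metric_add_left[of "x - y" y z] by (simp add: vf_diff)

lemma metric_zero_left: "z \<in> V \<Longrightarrow> G 0 z = 0"
  using metric_diff_left[of 0 0 z] by (simp add: vf_zero)

lemma metric_uminus_left: "x \<in> V \<Longrightarrow> z \<in> V \<Longrightarrow> G (- x) z = - G x z"
  using metric_diff_left[of 0 x z] by (simp add: vf_zero metric_zero_left)

lemma metric_add_right: "x \<in> V \<Longrightarrow> y \<in> V \<Longrightarrow> z \<in> V \<Longrightarrow> G z (x + y) = G z x + G z y"
  by (simp add: metric_commute[of z] metric_add_left vf_add)

lemma metric_diff_right: "x \<in> V \<Longrightarrow> y \<in> V \<Longrightarrow> z \<in> V \<Longrightarrow> G z (x - y) = G z x - G z y"
  by (simp add: metric_commute[of z] metric_diff_left vf_diff)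

lemma metric_fscale_right: "f \<in> S \<Longrightarrow> x \<in> V \<Longrightarrow> y \<in> V \<Longrightarrow> G y (fscale f x) = f * G y x"
  by (simp add: metric_commute[of y] metric_fscale_left vf_fscale)

end

text \<open>Instantiated both for the connection with torsion and for the Levi-Civita connection, so
  that the product rule for \<open>G\<close> is available for both.\<close>

locale metric_connection = metric_manifold A r s g + connection A D
  for A :: "('a::{t2_space,second_countable_topology}, 'b::euclidean_space) atlas"
    and r s :: nat and g :: "'a \<Rightarrow> 'a tvec \<Rightarrow> 'a tvec \<Rightarrow> real" and D :: "'a connection" +
  assumes parallel: "x \<in> V \<Longrightarrow> y \<in> V \<Longrightarrow> z \<in> V \<Longrightarrow> cov_bilinear D g x y z = 0"
begin

lemma along_metric:
  "x \<in> V \<Longrightarrow> y \<in> V \<Longrightarrow> z \<in> V \<Longrightarrow> along x (G y z) = G (D x y) z + G y (D x z)"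
  using parallel[of x y z] by (simp add: cov_bilinear_def diff_diff_eq)

lemma curvature4_tensor: "tensor04 A (curvature4 g D)"
proof -
  note V = vf_add vf_fscale vf_curvature
  \<comment> \<open>Linearity in the second slot is carried over from the first by
    skew-symmetry.\<close>
  have right: "curvature D x (y + u) z = curvature D x y z + curvature D x u z"
    if "x \<in> V" "y \<in> V" "z \<in> V" "u \<in> V" for x y z u
    using that curvature_add_left[of y u x z]
    by (simp add: curvature_swap[of _ x] vf_add)
  have right': "curvature D x (fscale f y) z = fscale f (curvature D x y z)"
    if "x \<in> V" "y \<in> V" "z \<in> V" "f \<in> S" for x y z f
    using that curvature_fscale_left[of y x z f]
    by (simp add: curvature_swap[of _ x] vf_fscale) (simp add: fscale_def tscale_def fun_eq_iff)
  show ?thesis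
    unfolding tensor04_def curvature4_def
    by (simp add: V metric_smooth right right' curvature_add_left curvature_add_right
        curvature_fscale_left curvature_fscale_right metric_add_left metric_add_right
        metric_fscale_left metric_fscale_right)
qed

text \<open>The operator \<open>x y - y x - lie_bracket x y\<close> annihilates the function
  \<open>G z w\<close>. Expanding it with the product rule for \<open>G\<close>, the mixed terms
  \<open>G (D y z) (D x w)\<close> and \<open>G (D x z) (D y w)\<close> cancel, and what remains is
  \<open>G (curvature D x y z) w + G z (curvature D x y w) = 0\<close>.\<close>

lemma curvature4_skew_right:
  assumes V: "x \<in> V" "y \<in> V" "z \<in> V" "w \<in> V"
  shows "curvature4 g D x y z w = - curvature4 g D x y w z"
proof -
  note vf = V vf_conn vf_lie_bracket vf_diff
  have "G (curvature D x y z) w p + G z (curvature D x y w) p = 0" for p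
  proof -
    have "along x (along y (G z w)) p = G (D x (D y z)) w p + G (D y z) (D x w) p
        + G (D x z) (D y w) p + G z (D x (D y w)) p"
      and "along y (along x (G z w)) p = G (D y (D x z)) w p + G (D x z) (D y w) p
        + G (D y z) (D x w) p + G z (D y (D x w)) p"
      by (simp_all add: vf along_metric along_add metric_smooth)
    moreover have "along (lie_bracket x y) (G z w) p
        = G (D (lie_bracket x y) z) w p + G z (D (lie_bracket x y) w) p"
      by (simp add: vf along_metric)
    moreover have "G (curvature D x y z) w p
        = G (D x (D y z)) w p - G (D y (D x z)) w p - G (D (lie_bracket x y) z) w p"
      and "G z (curvature D x y w) p
        = G z (D x (D y w)) p - G z (D y (D x w)) p - G z (D (lie_bracket x y) w) p"
      by (simp_all add: curvature_def vf metric_diff_left metric_diff_right)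
    moreover have "along (lie_bracket x y) (G z w) p
        = along x (along y (G z w)) p - along y (along x (G z w)) p"
      by (simp add: along_lie_bracket)
    ultimately show ?thesis
      by argo
  qed
  then have "G (curvature D x y z) w + G z (curvature D x y w) = 0"
    by (simp add: fun_eq_iff)
  then show ?thesis
    by (simp add: curvature4_def metric_commute[of z] V vf_curvature eq_neg_iff_add_eq_0)
qed

end

section \<open>Parallel totally skew-symmetric torsion\<close>

text \<open>Here \<open>N\<close> is the Levi-Civita connection: it preserves \<open>g\<close> and
  has no torsion. \<open>D\<close> preserves the same metric and has parallel, totally
  skew-symmetric torsion.\<close>

locale parallel_skew_torsion = metric_connection A r s g D + lc: metric_connection A r s g N
  for A :: "('a::{t2_space,second_countable_topology}, 'b::euclidean_space) atlas"
    and r s :: nat and g :: "'a \<Rightarrow> 'a tvec \<Rightarrow> 'a tvec \<Rightarrow> real" and D N :: "'a connection" +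
  assumes lc_torsion: "x \<in> V \<Longrightarrow> y \<in> V \<Longrightarrow> torsion N x y = 0"
    and torsion3_swap12:
      "x \<in> V \<Longrightarrow> y \<in> V \<Longrightarrow> z \<in> V \<Longrightarrow> torsion3 g D x y z = - torsion3 g D y x z"
    and torsion3_swap23:
      "x \<in> V \<Longrightarrow> y \<in> V \<Longrightarrow> z \<in> V \<Longrightarrow> torsion3 g D x y z = - torsion3 g D x z y"
    and torsion_parallel:
      "x \<in> V \<Longrightarrow> y \<in> V \<Longrightarrow> z \<in> V \<Longrightarrow> cov_tensor12 D (torsion D) x y z = 0"
begin

section \<open>Symmetries and derivatives of the torsion 3-form\<close>

abbreviation "T \<equiv> torsion D"

lemmas vf = vf_conn lc.vf_conn vf_torsion vf_lie_bracket vf_add vf_diff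

lemma torsion_swap12: "x \<in> V \<Longrightarrow> y \<in> V \<Longrightarrow> z \<in> V \<Longrightarrow> G (T x y) z = - G (T y x) z"
  using torsion3_swap12[of x y z] by (simp add: torsion3_def)

lemma torsion_swap23: "x \<in> V \<Longrightarrow> y \<in> V \<Longrightarrow> z \<in> V \<Longrightarrow> G (T x y) z = - G (T x z) y"
  using torsion3_swap23[of x y z] by (simp add: torsion3_def)

text \<open>A cyclic shift is a product of two transpositions. It serves to move the first argument
  of \<open>T\<close> into a slot of \<open>G\<close>, where linearity is already known.\<close>

lemma torsion_cycle: "x \<in> V \<Longrightarrow> y \<in> V \<Longrightarrow> z \<in> V \<Longrightarrow> G (T x y) z = G (T y z) x"
  using torsion_swap12[of x y z] torsion_swap23[of y x z] by simp

lemma torsion_diff_left: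
  assumes "u \<in> V" "v \<in> V" "z \<in> V" "w \<in> V"
  shows "G (T (u - v) z) w = G (T u z) w - G (T v z) w"
  using assms by (simp add: torsion_cycle[of _ z w] vf metric_diff_right)

text \<open>Since both \<open>g\<close> and \<open>T\<close> are parallel for \<open>D\<close>, the
  3-form is differentiated by the plain product rule.\<close>

lemma along_torsion3:
  assumes "x \<in> V" "y \<in> V" "z \<in> V" "w \<in> V"
  shows "along x (G (T y z) w) = G (T (D x y) z) w + G (T y (D x z)) w + G (T y z) (D x w)"
proof -
  have "D x (T y z) = T (D x y) z + T y (D x z)"
    using torsion_parallel[of x y z] assms by (simp add: cov_tensor12_def diff_diff_eq)
  then show ?thesis
    using assms by (simp add: along_metric metric_add_left vf)
qed

text \<open>The defect \<open>b\<close> of the formula is skew in its last two arguments, because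
  both connections are metric and \<open>T\<close> is skew there. It is symmetric in the first two,
  because the torsion of \<open>D\<close> exceeds that of \<open>N\<close> by exactly
  \<open>T\<close>. These symmetries force \<open>b\<close> to vanish.\<close>

lemma conn_eq_levi_civita_plus_torsion:
  assumes x: "x \<in> V" and y: "y \<in> V" and z: "z \<in> V"
  shows "G (D x y) z = G (N x y) z + (\<lambda>p. 1 / 2 * G (T x y) z p)"
proof
  fix p
  define b where "b u v w = G (D u v) w p - G (N u v) w p - 1 / 2 * G (T u v) w p" for u v w
  have skew: "b u v w = - b u w v" if "u \<in> V" "v \<in> V" "w \<in> V" for u v w
    using that fun_cong[OF along_metric[of u v w], of p] fun_cong[OF lc.along_metric[of u v w], of p]
      fun_cong[OF torsion_swap23[of u v w], of p] metric_commute[of v "D u w"]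
      metric_commute[of v "N u w"]
    by (simp add: b_def vf)
  have sym: "b u v w = b v u w" if "u \<in> V" "v \<in> V" "w \<in> V" for u v w
  proof -
    have "D u v - D v u = T u v + (N u v - N v u)"
      using lc_torsion[of u v] that by (simp add: torsion_def)
    then have "G (D u v - D v u) w p = G (T u v + (N u v - N v u)) w p"
      by simp
    then show ?thesis
      using that fun_cong[OF torsion_swap12[of u v w], of p]
      by (simp add: b_def vf metric_add_left metric_diff_left)
  qed
  \<comment> \<open>Alternating the two transpositions six times returns to the original order, with
    three sign changes on the way.\<close>
  have "b x y z = - b x y z"
    using skew[of x y z] skew[of y z x] skew[of z x y] sym[of x y z] sym[of y z x] sym[of z x y]
      x y z by simp
  then show "G (D x y) z p = (G (N x y) z + (\<lambda>p. 1 / 2 * G (T x y) z p)) p"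
    by (simp add: b_def)
qed

text \<open>The first-order comparison of \<open>D\<close> and \<open>N\<close> is differentiated
  along \<open>x\<close>. All correction terms are expressed through \<open>D\<close>, so that
  exchanging \<open>x\<close> and \<open>y\<close> later cancels
  \<open>T y (D x z) + T x (D y z)\<close> and makes the torsion of \<open>D\<close> appear in the
  first argument of \<open>T\<close>.\<close>

lemma conn_conn_eq:
  assumes x: "x \<in> V" and y: "y \<in> V" and z: "z \<in> V" and w: "w \<in> V"
  shows "G (D x (D y z)) w p = G (N x (N y z)) w p
    + 1 / 2 * (G (T (D x y) z) w p + G (T y (D x z)) w p + G (T x (D y z)) w p)
    + 1 / 4 * G (T y z) (T x w) p"
proof -
  note V = x y z w vf
  have "along x (G (D y z) w) p
      = along x (G (N y z) w) p + 1 / 2 * along x (G (T y z) w) p"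
    unfolding conn_eq_levi_civita_plus_torsion[OF y z w]
    by (subst along_add) (simp_all only: V along_cmult metric_smooth smooth_cmult plus_fun_apply)
  then have "G (D x (D y z)) w p + G (D y z) (D x w) p
      = G (N x (N y z)) w p + G (N y z) (N x w) p
      + 1 / 2 * (G (T (D x y) z) w p + G (T y (D x z)) w p + G (T y z) (D x w) p)"
    using along_metric[of x "D y z" w] lc.along_metric[of x "N y z" w]
      along_torsion3[of x y z w]
    by (simp add: V)
  \<comment> \<open>The mixed term is compared with \<open>G (N y z) (N x w)\<close> by replacing
    one factor at a time. Going back from \<open>N y z\<close> to \<open>D y z\<close> in the
    correction produces a product of two factors 1/2, hence the coefficient 1/4.\<close>
  moreover have "G (D y z) (D x w) p = G (N y z) (D x w) p + 1 / 2 * G (T y z) (D x w) p"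
    by (simp add: V conn_eq_levi_civita_plus_torsion)
  moreover have "G (N y z) (D x w) p = G (N y z) (N x w) p + 1 / 2 * G (T x w) (N y z) p"
    using conn_eq_levi_civita_plus_torsion[of x w "N y z"]
    by (simp add: V metric_commute[of "N y z"])
  moreover have "G (T x w) (D y z) p = G (T x w) (N y z) p + 1 / 2 * G (T y z) (T x w) p"
    using conn_eq_levi_civita_plus_torsion[of y z "T x w"]
    by (simp add: V metric_commute[of "T x w"])
  moreover have "G (T x (D y z)) w p = - G (T x w) (D y z) p"
    using torsion_swap23[of x "D y z" w] by (simp add: V)
  ultimately show ?thesis
    by argo
qed

section \<open>The cyclic sum \<sigma> in the curvature and in the exterior derivative of the
  torsion\<close>

definition \<sigma> where
  "\<sigma> x y z w = cyclic_sum (\<lambda>x y z. G (T x y) (T z w)) x y z"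

text \<open>Skew-symmetrizing the second derivatives in \<open>x\<close>, \<open>y\<close> and
  subtracting the bracket term leaves half of \<open>G (T (T x y) z) w\<close>, which equals half of
  \<open>G (T x y) (T z w)\<close>. The quarter terms are those of \<sigma> except for
  \<open>G (T x y) (T z w)\<close>; completing them to \<sigma> reduces its coefficient from 1/2 to
  1/4.\<close>

lemma curvature_eq:
  assumes V: "x \<in> V" "y \<in> V" "z \<in> V" "w \<in> V"
  shows "curvature4 g D x y z w p = curvature4 g N x y z w p
    + 1 / 4 * G (T x y) (T z w) p + 1 / 4 * \<sigma> x y z w p"
proof -
  note V = V vf
  have "T x y = D x y - D y x - lie_bracket x y"
    by (simp add: torsion_def)
  then have "G (T (T x y) z) w p
      = G (T (D x y) z) w p - G (T (D y x) z) w p - G (T (lie_bracket x y) z) w p"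
    by (simp add: V torsion_diff_left)
  moreover have "G (T (T x y) z) w p = G (T x y) (T z w) p"
    by (simp add: V torsion_cycle[of "T x y"] metric_commute[of "T x y"])
  moreover have "G (D (lie_bracket x y) z) w p = G (N (lie_bracket x y) z) w p
      + 1 / 2 * G (T (lie_bracket x y) z) w p"
    by (simp add: V conn_eq_levi_civita_plus_torsion)
  moreover have "curvature4 g D x y z w p
      = G (D x (D y z)) w p - G (D y (D x z)) w p - G (D (lie_bracket x y) z) w p"
    by (simp add: V curvature4_def curvature_def metric_diff_left)
  moreover have "curvature4 g N x y z w p
      = G (N x (N y z)) w p - G (N y (N x z)) w p - G (N (lie_bracket x y) z) w p"
    by (simp add: V curvature4_def curvature_def metric_diff_left)
  moreover have "G (T x z) (T y w) p = - G (T z x) (T y w) p"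
    using torsion_swap12[of x z "T y w"] by (simp add: V)
  moreover have "\<sigma> x y z w p = G (T x y) (T z w) p + G (T y z) (T x w) p + G (T z x) (T y w) p"
    by (simp add: \<sigma>_def cyclic_sum_def)
  ultimately show ?thesis
    using conn_conn_eq[of x y z w p] conn_conn_eq[of y x z w p] V(1-4) by argo
qed

text \<open>Replacing each bracket by \<open>D a b - D b a - T a b\<close>, the covariant
  derivatives cancel against those from differentiating the parallel 3-form. The six torsion
  products left over are the three terms of \<sigma>, each occurring twice.\<close>

lemma ext_deriv3_torsion:
  assumes V: "x \<in> V" "y \<in> V" "z \<in> V" "w \<in> V"
  shows "ext_deriv3 (torsion3 g D) x y z w p = 2 * \<sigma> x y z w p"
proof -
  note V = V vf
  have br: "G (T (lie_bracket a b) c) d p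
      = G (T c d) (D a b) p - G (T c d) (D b a) p - G (T a b) (T c d) p"
    if "a \<in> V" "b \<in> V" "c \<in> V" "d \<in> V" for a b c d
  proof -
    have "lie_bracket a b = D a b - D b a - T a b"
      by (simp add: torsion_def)
    then show ?thesis
      using that by (simp add: V metric_diff_right torsion_cycle[of _ c d] metric_commute[of "T a b"])
  qed
  \<comment> \<open>As in \<open>br\<close>, every covariant derivative is moved to the last slot of
    \<open>G\<close>, so that equal terms become syntactically comparable.\<close>
  have al: "along a (G (T b c) d) p
      = G (T c d) (D a b) p - G (T b d) (D a c) p + G (T b c) (D a d) p"
    if "a \<in> V" "b \<in> V" "c \<in> V" "d \<in> V" for a b c d
    using that torsion_cycle[of "D a b" c d] torsion_swap23[of b "D a c" d]
    by (simp add: V along_torsion3)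
  have sw: "G (T b a) c p = - G (T a b) c p" if "a \<in> V" "b \<in> V" "c \<in> V" for a b c
    using that torsion_swap12[of b a c] by simp
  have comm: "G (T a b) (T c d) p = G (T c d) (T a b) p"
    if "a \<in> V" "b \<in> V" "c \<in> V" "d \<in> V" for a b c d
    using that metric_commute[of "T a b" "T c d"] by (simp add: V)
  show ?thesis
    unfolding ext_deriv3_def torsion3_def \<sigma>_def cyclic_sum_def
    using comm[of x y z w] comm[of y z x w] comm[of x z y w] sw[of x z "T y w"]
      sw[of x z "D y w"] sw[of x z "D w y"]
    by (simp add: V al br)
qed

text \<open>In the cyclic sum of \<open>curvature_eq\<close> the Levi-Civita part vanishes by the
  Bianchi identity. The products \<open>G (T x y) (T z w)\<close> contribute \<sigma>/4, and the
  cyclically invariant \<sigma>/4 occurs three times.\<close>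

lemma curvature4_cyclic:
  assumes V: "x \<in> V" "y \<in> V" "z \<in> V" "w \<in> V"
  shows "cyclic_sum (\<lambda>x y z. curvature4 g D x y z w) x y z p = \<sigma> x y z w p"
proof -
  have "G (cyclic_sum (curvature N) x y z) w p = 0"
    using V lc.torsion_free_bianchi[OF lc_torsion] by (simp add: metric_zero_left)
  then have "cyclic_sum (\<lambda>x y z. curvature4 g N x y z w) x y z p = 0"
    using V by (simp add: cyclic_sum_def curvature4_def metric_add_left vf lc.vf_curvature)
  moreover have "\<sigma> y z x w p = \<sigma> x y z w p" "\<sigma> z x y w p = \<sigma> x y z w p"
    by (simp_all add: \<sigma>_def cyclic_sum_def)
  moreover have "\<sigma> x y z w p = G (T x y) (T z w) p + G (T y z) (T x w) p + G (T z x) (T y w) p"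
    by (simp add: \<sigma>_def cyclic_sum_def)
  ultimately show ?thesis
    unfolding cyclic_sum_def plus_fun_apply
    using curvature_eq[of x y z w p] curvature_eq[of y z x w p] curvature_eq[of z x y w p] V
    by simp argo
qed

end

text \<open>\<open>D\<phi> = 0\<close> makes \<open>K(x,y)\<close> commute with \<open>\<phi>\<close>, and \<open>D\<eta> = 0\<close> gives \<open>\<eta>(K(x,y)z) = 0\<close>, which
  removes the extra term in the compatibility of \<open>g\<close> and \<open>\<phi>\<close>.\<close>

lemma natural_curvature4_phi:
  assumes M: "almost_contact_B_metric_manifold A n \<phi> \<xi> \<eta> g"
    and nat: "natural_connection A \<phi> \<xi> \<eta> g D"
    and x: "x \<in> vector_fields A" and y: "y \<in> vector_fields A"
    and z: "z \<in> vector_fields A" and w: "w \<in> vector_fields A"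
  shows "curvature4 g D x y (app \<phi> z) (app \<phi> w) = - curvature4 g D x y z w"
proof -
  interpret connection A D
    using M nat
    by unfold_locales (auto simp: almost_contact_B_metric_manifold_def natural_connection_def)
  note V = x y z vf_conn vf_lie_bracket vf_diff
  have endo: "endomorphism_field A \<phi>" and form: "one_form A \<eta>"
    using M by (auto simp: almost_contact_B_metric_manifold_def)
  have phi_add: "app \<phi> (u + v) = app \<phi> u + app \<phi> v" if "u \<in> V" "v \<in> V" for u v
    using endo that by (auto simp: endomorphism_field_def app_def vf_tangent)
  have phi_diff: "app \<phi> (u - v) = app \<phi> u - app \<phi> v" if "u \<in> V" "v \<in> V" for u v
    using phi_add[of "u - v" v] that by (simp add: vf_diff)
  have conn_phi: "D u (app \<phi> v) = app \<phi> (D u v)" if "u \<in> V" "v \<in> V" for u v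
    using nat that by (simp add: natural_connection_def cov_endo_def)
  have curv_phi: "curvature D x y (app \<phi> z) = app \<phi> (curvature D x y z)"
    by (simp add: curvature_def V conn_phi phi_diff)
  have eta_add: "app \<eta> (u + v) = app \<eta> u + app \<eta> v" if "u \<in> V" "v \<in> V" for u v
    using form that by (auto simp: one_form_def app_def vf_tangent)
  have eta_diff: "app \<eta> (u - v) = app \<eta> u - app \<eta> v" if "u \<in> V" "v \<in> V" for u v
    using eta_add[of "u - v" v] that by (simp add: vf_diff)
  have conn_eta: "app \<eta> (D u v) = along u (app \<eta> v)" if "u \<in> V" "v \<in> V" for u v
    using nat that by (simp add: natural_connection_def cov_one_form_def)
  \<comment> \<open>Parallelism turns \<eta> after \<open>D u\<close> into the derivative along
    \<open>u\<close> of a function, so this is the commutator of two derivatives minus the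
    derivative along the bracket.\<close>
  have curv_eta: "app \<eta> (curvature D x y z) = 0"
    by (simp add: curvature_def V conn_eta eta_diff along_lie_bracket)
  have compat: "g p (\<phi> p v) (\<phi> p u) = - g p v u + \<eta> p v * \<eta> p u"
    if "v \<in> tangent_space A p" "u \<in> tangent_space A p" for p u v
    using M that by (simp add: almost_contact_B_metric_manifold_def)
  have "app2 g (app \<phi> (curvature D x y z)) (app \<phi> w) p
      = - app2 g (curvature D x y z) w p + app \<eta> (curvature D x y z) p * app \<eta> w p" for p
    unfolding app2_def app_def by (intro compat vf_tangent vf_curvature x y z w)
  then show ?thesis
    by (simp add: curvature4_def curv_phi curv_eta fun_eq_iff)
qed

theorem theorem9:
  fixes A :: "('a::{t2_space,second_countable_topology}, 'b::euclidean_space) atlas"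
    and n :: nat
    and \<phi> :: "'a \<Rightarrow> 'a tvec \<Rightarrow> 'a tvec"
    and \<xi> :: "'a vfield"
    and \<eta> :: "'a \<Rightarrow> 'a tvec \<Rightarrow> real"
    and g :: "'a \<Rightarrow> 'a tvec \<Rightarrow> 'a tvec \<Rightarrow> real"
    and Nabla D :: "'a connection"
  assumes "almost_contact_B_metric_manifold A n \<phi> \<xi> \<eta> g"
    and "levi_civita A g Nabla"
    and "phiKT_connection A \<phi> \<xi> \<eta> g D"
    and "parallel_torsion A D"
  shows
    "((phi_kaehler_type A \<phi> (curvature4 g D) \<and>
       (\<forall>x\<in>vector_fields A. \<forall>y\<in>vector_fields A. \<forall>z\<in>vector_fields A. \<forall>w\<in>vector_fields A. \<forall>p.
          curvature4 g D x y z w p =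
            curvature4 g Nabla x y z w p + 1 / 4 * app2 g (torsion D x y) (torsion D z w) p))
      \<longleftrightarrow>
      (\<forall>x\<in>vector_fields A. \<forall>y\<in>vector_fields A. \<forall>z\<in>vector_fields A. \<forall>w\<in>vector_fields A.
          ext_deriv3 (torsion3 g D) x y z w = 0))
     \<and>
     ((\<forall>x\<in>vector_fields A. \<forall>y\<in>vector_fields A. \<forall>z\<in>vector_fields A. \<forall>w\<in>vector_fields A.
          ext_deriv3 (torsion3 g D) x y z w = 0)
      \<longleftrightarrow>
      (\<forall>x\<in>vector_fields A. \<forall>y\<in>vector_fields A. \<forall>z\<in>vector_fields A. \<forall>w\<in>vector_fields A.
          cyclic_sum (\<lambda>x y z. app2 g (torsion D x y) (torsion D z w)) x y z = 0))"
proof -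
  interpret manifold A
    using assms(1) by unfold_locales (simp add: almost_contact_B_metric_manifold_def)
  have natural: "natural_connection A \<phi> \<xi> \<eta> g D"
    using assms(3) by (simp add: phiKT_connection_def)
  have skew: "torsion3 g D x y z = - torsion3 g D y x z"
      "torsion3 g D x y z = - torsion3 g D x z y"
    if "x \<in> V" "y \<in> V" "z \<in> V" for x y z
    using assms(3) that unfolding phiKT_connection_def by blast+
  interpret metric_connection A n "n + 1" g D
    using assms(1) natural
    by unfold_locales (simp_all add: almost_contact_B_metric_manifold_def natural_connection_def)
  interpret lc: metric_connection A n "n + 1" g Nabla
    using assms(2) by unfold_locales (simp_all add: levi_civita_def)
  interpret parallel_skew_torsion A n "n + 1" g D Nabla
  proof unfold_locales
    show "torsion Nabla x y = 0" if "x \<in> V" "y \<in> V" for x y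
      using assms(2) that by (simp add: levi_civita_def)
    show "cov_tensor12 D (torsion D) x y z = 0" if "x \<in> V" "y \<in> V" "z \<in> V" for x y z
      using assms(4) that by (simp add: parallel_torsion_def)
  qed (fact skew)+
  let ?all = "\<lambda>P. \<forall>x\<in>V. \<forall>y\<in>V. \<forall>z\<in>V. \<forall>w\<in>V. P x y z w"
  let ?form = "\<lambda>x y z w. \<forall>p. curvature4 g D x y z w p =
    curvature4 g Nabla x y z w p + 1 / 4 * app2 g (torsion D x y) (torsion D z w) p"
  \<comment> \<open>Each condition is translated into the vanishing of \<sigma>; condition (iii) is
    this vanishing by definition.\<close>
  have closed_iff: "?all (\<lambda>x y z w. ext_deriv3 (torsion3 g D) x y z w = 0)
      \<longleftrightarrow> ?all (\<lambda>x y z w. \<sigma> x y z w = 0)"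
    using ext_deriv3_torsion by (simp add: fun_eq_iff)
  have form_iff: "?all ?form \<longleftrightarrow> ?all (\<lambda>x y z w. \<sigma> x y z w = 0)"
    using curvature_eq by (simp add: fun_eq_iff)
  have "phi_kaehler_type A \<phi> (curvature4 g D)" if "?all (\<lambda>x y z w. \<sigma> x y z w = 0)"
    unfolding phi_kaehler_type_def
  proof (intro conjI ballI)
    fix x y z w assume V: "x \<in> V" "y \<in> V" "z \<in> V" "w \<in> V"
    show "curvature4 g D x y z w = - curvature4 g D y x z w"
      using V by (simp add: curvature4_def curvature_swap[of y x] metric_uminus_left vf_curvature)
    show "curvature4 g D x y z w = - curvature4 g D x y w z"
      using V by (rule curvature4_skew_right)
    \<comment> \<open>The cyclic sum equals \<sigma>, so the vanishing of \<sigma> enters at this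
      point.\<close>
    show "cyclic_sum (\<lambda>x y z. curvature4 g D x y z w) x y z = 0"
      using V that curvature4_cyclic[OF V] by (simp add: fun_eq_iff)
    show "curvature4 g D x y (app \<phi> z) (app \<phi> w) = - curvature4 g D x y z w"
      using assms(1) natural V by (rule natural_curvature4_phi)
  qed (rule curvature4_tensor)
  then show ?thesis
    using form_iff closed_iff unfolding \<sigma>_def by blast
qed

end
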